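(* For all non-negative integers $n,m,p,q$ and all complex numbers $z,w,\gamma,a,b,c$, $$H_{n,m}^{(p,q)}(az,bw|c\gamma)=n!\,m!\sum_{k=0}^{\lfloor n/p\rfloor\wedge\lfloor m/q\rfloor}\frac{(c-a^{p}b^q)^{k}\,\gamma^{k}\,a^{n-pk}\,b^{m-qk}}{k!\,(n-pk)!\,(m-qk)!}\,H_{n-pk,m-qk}^{(p,q)}(z,w|\gamma).$$
   Context: For non-negative integers $n,m,p,q$ and complex $z,w,\gamma$, $$H_{n,m}^{(p,q)}(z,w|\gamma)= n!\,m!\sum_{k=0}^{\lfloor n/p\rfloor\wedge\lfloor m/q\rfloor}\frac{\gamma^k}{k!}\frac{z^{n-pk}}{(n-pk)!}\frac{w^{m-qk}}{(m-qk)!},$$ where $s\wedge t=\min\{s,t\}$ and $\lfloor j/0\rfloor=+\infty$ by convention (so for $p=q=0$ such a sum is an infinite series and $H_{n,m}^{(0,0)}(z,w|\gamma)=e^{\gamma}z^nw^m$); $0^0=1$. *)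

theory Defs
  imports Complex_Main "HOL-Analysis.Infinite_Sum" "HOL-Library.Extended_Nat"
begin

definition floor_quot :: "nat \<Rightarrow> nat \<Rightarrow> enat"
  where "floor_quot j d = (if d = 0 then \<infinity> else enat (j div d))"

definition summation_range :: "nat \<Rightarrow> nat \<Rightarrow> nat \<Rightarrow> nat \<Rightarrow> nat set"
  where "summation_range p q n m = {k. enat k \<le> min (floor_quot n p) (floor_quot m q)}"

text \<open>
  The range of summation is finite unless \<open>p = q = 0\<close>, and \<open>infsum\<close> over a finite set is the
  ordinary sum. The natural number subtractions below never truncate on the range of summation.
\<close>

definition H :: "nat \<Rightarrow> nat \<Rightarrow> nat \<Rightarrow> nat \<Rightarrow> complex \<Rightarrow> complex \<Rightarrow> complex \<Rightarrow> complex"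
  where "H p q n m z w \<gamma> = fact n * fact m *
    (\<Sum>\<^sub>\<infinity>k\<in>summation_range p q n m.
       \<gamma> ^ k / fact k * (z ^ (n - p * k) / fact (n - p * k)) * (w ^ (m - q * k) / fact (m - q * k)))"

lemma mem_summation_range_iff:
  "k \<in> summation_range p q n m \<longleftrightarrow> p * k \<le> n \<and> q * k \<le> m"
  by (auto simp: summation_range_def floor_quot_def less_eq_div_iff_mult_less_eq mult.commute)

lemma summation_range_0_0: "summation_range 0 0 n m = UNIV"
  by (auto simp: mem_summation_range_iff)

lemma finite_summation_range:
  assumes "p > 0 \<or> q > 0"
  shows "finite (summation_range p q n m)"
proof (rule finite_subset)
  show "summation_range p q n m \<subseteq> {..max n m}"
  proof
    fix k assume "k \<in> summation_range p q n m"
    then have k: "p * k \<le> n" "q * k \<le> m" by (auto simp: mem_summation_range_iff)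
    from assms have "k \<le> p * k \<or> k \<le> q * k" by auto
    with k show "k \<in> {..max n m}" unfolding atMost_iff by linarith
  qed
qed simp

lemma exp_has_sum: "((\<lambda>k. x ^ k / fact k) has_sum exp x) UNIV" for x :: complex
proof (rule norm_summable_imp_has_sum)
  show "summable (\<lambda>k. norm (x ^ k / fact k))"
    using summable_norm_exp[of x] by (simp add: scaleR_conv_of_real divide_inverse mult.commute)
  show "(\<lambda>k. x ^ k / fact k) sums exp x"
    using exp_converges[of x] by (simp add: scaleR_conv_of_real divide_inverse mult.commute)
qed

text \<open>All series of the shape occurring here converge, so \<open>infsum\<close> never takes its default value.\<close>

lemma summable_on_summation_range:
  fixes x :: complex and G :: "nat \<Rightarrow> nat \<Rightarrow> complex"
  shows "(\<lambda>k. x ^ k / fact k * G (n - p * k) (m - q * k)) summable_on summation_range p q n m"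
proof (cases "p = 0 \<and> q = 0")
  case True
  have "(\<lambda>k. x ^ k / fact k) summable_on UNIV"
    using exp_has_sum by (rule has_sum_imp_summable)
  then have "(\<lambda>k. x ^ k / fact k * G n m) summable_on UNIV"
    by (rule summable_on_cmult_left)
  then show ?thesis
    using True by (simp add: summation_range_0_0)
next
  case False
  then show ?thesis by (intro summable_on_finite finite_summation_range) auto
qed

lemma H_0_0: "H 0 0 n m z w \<gamma> = exp \<gamma> * z ^ n * w ^ m"
proof -
  have "((\<lambda>k. \<gamma> ^ k / fact k * (z ^ n / fact n * (w ^ m / fact m))) has_sum
          exp \<gamma> * (z ^ n / fact n * (w ^ m / fact m))) UNIV"
    by (rule has_sum_cmult_left[OF exp_has_sum])
  then show ?thesis
    by (simp add: H_def summation_range_0_0 infsumI mult.assoc)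
qed

end

theory Submission imports Defs begin

text \<open>
  Expanding the inner polynomial turns the right-hand side into a sum over pairs \<open>(k, j)\<close>.
  Collect the terms with \<open>k + j = N\<close>: since \<open>a^(n - p k) = a^(n - p N) (a^p)^j\<close>, and likewise for
  \<open>b\<close>, the coefficients combine by the binomial theorem to \<open>((c - a^p b^q) + a^p b^q)^N = c^N\<close>.
  For \<open>p = q = 0\<close> both sides are exponentials.
\<close>

text \<open>The map \<open>(k, j)\<close> to \<open>(k + j, k)\<close> is a bijection of the index
  sets: once \<open>p * k \<le> n\<close>, the bound \<open>p * j \<le> n - p * k\<close> says
  exactly \<open>p * (k + j) \<le> n\<close>, and likewise for \<open>q\<close>. The assumption
  makes all ranges finite, so double sums become sums over pairs.\<close>

lemma sum_summation_range_collect: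
  fixes f :: "nat \<Rightarrow> nat \<Rightarrow> 'a :: comm_monoid_add"
  assumes "p > 0 \<or> q > 0"
  shows "(\<Sum>k\<in>summation_range p q n m. \<Sum>j\<in>summation_range p q (n - p * k) (m - q * k). f k j)
    = (\<Sum>N\<in>summation_range p q n m. \<Sum>k\<le>N. f k (N - k))"
proof -
  have "(\<Sum>k\<in>summation_range p q n m. \<Sum>j\<in>summation_range p q (n - p * k) (m - q * k). f k j)
    = (\<Sum>(k, j)\<in>(SIGMA k:summation_range p q n m. summation_range p q (n - p * k) (m - q * k)). f k j)"
    using assms by (intro sum.Sigma) (auto intro: finite_summation_range)
  also have "\<dots> = (\<Sum>(N, k)\<in>(SIGMA N:summation_range p q n m. {..N}). f k (N - k))"
  proof (rule sum.reindex_bij_witness[where i = "\<lambda>(N, k). (k, N - k)" and j = "\<lambda>(k, j). (k + j, k)"])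
    fix x assume "x \<in> (SIGMA N:summation_range p q n m. {..N})"
    then obtain N k where x: "x = (N, k)" and N: "p * N \<le> n" "q * N \<le> m" and "k \<le> N"
      by (auto simp: mem_summation_range_iff)
    \<comment> \<open>The range is closed downwards, so \<open>k\<close> inherits admissibility from
      \<open>N\<close>.\<close>
    moreover from this have "p * k \<le> n" "q * k \<le> m"
      by (meson le_trans mult_le_mono2)+
    ultimately show "(case x of (N, k) \<Rightarrow> (k, N - k)) \<in>
        (SIGMA k:summation_range p q n m. summation_range p q (n - p * k) (m - q * k))"
      by (auto simp: mem_summation_range_iff diff_mult_distrib2)
  qed (auto simp: mem_summation_range_iff algebra_simps)
  also have "\<dots> = (\<Sum>N\<in>summation_range p q n m. \<Sum>k\<le>N. f k (N - k))"
    using assms by (intro sum.Sigma[symmetric]) (auto intro: finite_summation_range)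
  finally show ?thesis .
qed

text \<open>This is the binomial theorem divided by \<open>fact N\<close>, the form in which the
  inner sums over \<open>k\<close> appear.\<close>

lemma binomial_divided_powers:
  fixes x y :: "'a :: field_char_0"
  shows "(\<Sum>k\<le>N. x ^ k / fact k * (y ^ (N - k) / fact (N - k))) = (x + y) ^ N / fact N"
  by (simp add: binomial_ring sum_divide_distrib binomial_fact field_simps)

lemma H_eq_sum:
  assumes "p > 0 \<or> q > 0"
  shows "H p q n m z w \<gamma> = fact n * fact m * (\<Sum>k\<in>summation_range p q n m.
    \<gamma> ^ k / fact k * (z ^ (n - p * k) / fact (n - p * k)) * (w ^ (m - q * k) / fact (m - q * k)))"
  using finite_summation_range[OF assms] by (simp add: H_def)

theorem proposition5p2:
  fixes n m p q :: nat and z w \<gamma> a b c :: complex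
  shows "H p q n m (a * z) (b * w) (c * \<gamma>) = fact n * fact m *
    (\<Sum>\<^sub>\<infinity>k\<in>summation_range p q n m.
       ((c - a ^ p * b ^ q) ^ k * \<gamma> ^ k * a ^ (n - p * k) * b ^ (m - q * k))
         / (fact k * fact (n - p * k) * fact (m - q * k))
       * H p q (n - p * k) (m - q * k) z w \<gamma>)"
proof (cases "p = 0 \<and> q = 0")
  case True
  \<comment> \<open>Here \<open>c - a ^ p * b ^ q\<close> is \<open>c - 1\<close> and the inner
    \<open>H\<close> does not depend on \<open>k\<close>, so \<open>?C\<close> gathers everything
    constant in \<open>k\<close> and an exponential series remains.\<close>
  let ?C = "a ^ n * b ^ m / (fact n * fact m) * (exp \<gamma> * z ^ n * w ^ m)"
  have "((\<lambda>k. ((c - 1) * \<gamma>) ^ k / fact k * ?C) has_sum exp ((c - 1) * \<gamma>) * ?C) UNIV"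
    by (rule has_sum_cmult_left[OF exp_has_sum])
  then have "(\<Sum>\<^sub>\<infinity>k. ((c - 1) * \<gamma>) ^ k / fact k * ?C) = exp ((c - 1) * \<gamma>) * ?C"
    by (rule infsumI)
  moreover have "exp (c * \<gamma>) = exp ((c - 1) * \<gamma>) * exp \<gamma>"
    by (simp add: algebra_simps flip: exp_add)
  ultimately show ?thesis
    using True by (simp add: H_0_0 summation_range_0_0 power_mult_distrib mult_ac)
next
  case False
  then have pq: "p > 0 \<or> q > 0" by auto
  define S where "S = summation_range p q n m"
  define d where "d = c - a ^ p * b ^ q"
  \<comment> \<open>The general term after expanding the inner \<open>H\<close>; its prefactor has
    cancelled \<open>fact (n - p * k) * fact (m - q * k)\<close>.\<close>
  define f where "f = (\<lambda>k j. d ^ k * \<gamma> ^ k * a ^ (n - p * k) * b ^ (m - q * k) / fact k *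
    (\<gamma> ^ j / fact j * (z ^ (n - p * k - p * j) / fact (n - p * k - p * j))
      * (w ^ (m - q * k - q * j) / fact (m - q * k - q * j))))"
  \<comment> \<open>The part of a collected term that depends on \<open>N\<close> alone, apart from
    \<gamma>: the leftover powers of \<open>a\<close> and \<open>b\<close> join those of
    \<open>z\<close> and \<open>w\<close>.\<close>
  define g where "g = (\<lambda>N. (a * z) ^ (n - p * N) / fact (n - p * N)
    * ((b * w) ^ (m - q * N) / fact (m - q * N)))"
  have collect: "f k (N - k) = \<gamma> ^ N * g N * (d ^ k / fact k * ((a ^ p * b ^ q) ^ (N - k) / fact (N - k)))"
    if "N \<in> S" "k \<le> N" for N k
  proof -
    from \<open>k \<le> N\<close> obtain j where N: "N = k + j" using le_Suc_ex by blast
    with that have "p * k + p * j \<le> n" "q * k + q * j \<le> m"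
      by (auto simp: S_def mem_summation_range_iff algebra_simps)
    \<comment> \<open>Admissibility of \<open>N\<close> keeps these subtractions from truncating.
      Splitting the exponents avoids division by \<open>a\<close> or \<open>b\<close>, so zero
      values are covered.\<close>
    then have "n - p * k = (n - p * N) + p * j" "m - q * k = (m - q * N) + q * j"
      by (auto simp: N algebra_simps)
    then have "a ^ (n - p * k) = a ^ (n - p * N) * (a ^ p) ^ j"
      "b ^ (m - q * k) = b ^ (m - q * N) * (b ^ q) ^ j"
      by (simp_all only: power_add power_mult)
    then show ?thesis
      by (simp add: f_def g_def N distrib_left power_add power_mult_distrib mult_ac)
  qed
  have "(\<Sum>k\<in>S. d ^ k * \<gamma> ^ k * a ^ (n - p * k) * b ^ (m - q * k)
        / (fact k * fact (n - p * k) * fact (m - q * k)) * H p q (n - p * k) (m - q * k) z w \<gamma>)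
    = (\<Sum>k\<in>S. \<Sum>j\<in>summation_range p q (n - p * k) (m - q * k). f k j)"
    by (simp add: H_eq_sum[OF pq] f_def sum_distrib_left mult_ac)
  also have "\<dots> = (\<Sum>N\<in>S. \<Sum>k\<le>N. f k (N - k))"
    unfolding S_def by (rule sum_summation_range_collect[OF pq])
  also have "\<dots> = (\<Sum>N\<in>S. \<gamma> ^ N * g N *
      (\<Sum>k\<le>N. d ^ k / fact k * ((a ^ p * b ^ q) ^ (N - k) / fact (N - k))))"
    by (simp add: collect sum_distrib_left)
  also have "\<dots> = (\<Sum>N\<in>S. \<gamma> ^ N * g N * (c ^ N / fact N))"
    unfolding binomial_divided_powers by (simp add: d_def)
  also have "\<dots> = (\<Sum>N\<in>S. (c * \<gamma>) ^ N / fact N * ((a * z) ^ (n - p * N) / fact (n - p * N))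
      * ((b * w) ^ (m - q * N) / fact (m - q * N)))"
    by (simp add: g_def power_mult_distrib mult_ac)
  finally show ?thesis
    using finite_summation_range[OF pq] by (simp add: H_eq_sum[OF pq] S_def d_def)
qed

end
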